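(* Let $k\in\mathbb{N}$ ($k\ge1$), $\delta>0$, $\tilde\epsilon>0$ and $\xi\in(\frac{\pi}{2}+\tilde\epsilon,\frac{3\pi}{2}-\tilde\epsilon)$ be fixed, and let $\beta=e^{i\xi}$. Let $\{\hat\alpha_n\}_{n\ge0}$ be a sequence of real Verblunsky coefficients (so $\hat\alpha_n\in(-1,1)$) having slow decay controlled by $f$. Set $t_M=M^{\frac{1+b}{2}}$ if $f(n)=-Cn^{-b}$ with $C>0$ and $b\in(0,1)$, and $t_M=\sqrt M$ otherwise. Then for all sufficiently large $M$ and $N$ (i.e. there exist $M_0,N_0$ such that for all integers $M\ge M_0$, $N\ge N_0$) the following holds. If $\{\alpha_n\}_{n\ge0}$ is a sequence of Verblunsky coefficients in $\mathbb{D}$ satisfying $\alpha_n\in P_{\alpha_M}$ for all $n\le M$ and $\alpha_n=\hat\alpha_n$ for all integers $n\ge0$ with $n\in(M-N(t_M+4),M]$, and $\zeta_1^{(M)},\dots,\zeta_M^{(M)}$ are the zeros of the paraorthogonal polynomial $\Phi_M^{(\beta)}$ associated with $\{\alpha_n\}_{n\geq0}$, ordered counterclockwise starting from $1$, then \[ \left|\frac{\arg\left(\zeta_k^{(M)}\right)}{2|f(M)|}-1\right|<\delta . \]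
   Context: Let $\mathbb{D}=\{z\in\mathbb{C}:|z|<1\}$. Given Verblunsky coefficients $\{\alpha_n\}_{n\ge0}\subset\mathbb{D}$, the monic orthogonal polynomials on the unit circle are defined by $\Phi_0=1$ and the Szegő recursion $\Phi_{n+1}(z)=z\Phi_n(z)-\overline{\alpha}_n\Phi_n^*(z)$, where $\Phi_n^*(z)=z^n\overline{\Phi_n(1/\bar z)}$. For $\beta\in\partial\mathbb{D}$ and $n\ge1$, the paraorthogonal polynomial is $\Phi_n^{(\beta)}(z)=z\Phi_{n-1}(z)-\overline{\beta}\,\Phi_{n-1}^*(z)$. It is known that its $n$ zeros are simple and lie on $\partial\mathbb{D}$; they are denoted $\zeta_1^{(n)},\dots,\zeta_n^{(n)}$, ordered counterclockwise starting from $1$, i.e. with $\arg$ taking values in $[0,2\pi)$, $0\le\arg\zeta_1^{(n)}<\dots<\arg\zeta_n^{(n)}<2\pi$. For $\alpha$ with $|\alpha+\frac12|<\frac12$, $P_\alpha=\{z\in\mathbb{D}:\mathrm{Re}(z)\le\mathrm{Re}(\alpha)\}$. A sequence of Verblunsky coefficients $\{\alpha_n\}_{n\ge0}$ has slow decay controlled by $f$ if $f$ is a non-positive function $f(n)$ of the positive integers (non-integer arguments such as $n-k\sqrt n$ are replaced by the closest integer) such that: (i) either $f(n)=-Cn^{-b}$ for some $b\in(0,1)$ and $C>0$, or $\lim_{n\to\infty}\sqrt n\,f(n-\sqrt n)^2=\infty$; (ii) $f(n)<f(n+1)<0$ for all $n>0$ and $\lim_{n\to\infty}f(n)=0$; (iii)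 $\lim_{n\to\infty}\frac{f(n-k\sqrt n)}{f(n)}=1$ for all $k\in\mathbb{N}$; (iv) $\lim_{n\to\infty}\frac{\alpha_n}{f(n)}=1$; (v) there is $m_0$ such that $\mathrm{Re}[\alpha_n]\le f(m)$ whenever $m\ge m_0$ and $0\le n\le m$. *)

theory Defs
  imports
    "HOL-Analysis.Analysis"
    "HOL-Computational_Algebra.Fundamental_Theorem_Algebra"
begin

definition verblunsky :: "(nat \<Rightarrow> complex) \<Rightarrow> bool" where
  "verblunsky \<alpha> \<longleftrightarrow> (\<forall>n. \<alpha> n \<in> ball 0 1)"

(* The polynomial z ^ n * cnj (p (1 / cnj z)), for degree p <= n; the reversal is with respect
   to the nominal degree n (see poly_szego_rev below). *)
definition szego_rev :: "nat \<Rightarrow> complex poly \<Rightarrow> complex poly" where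
  "szego_rev n p = (\<Sum>i\<le>n. monom (cnj (coeff p (n - i))) i)"

primrec opuc :: "(nat \<Rightarrow> complex) \<Rightarrow> nat \<Rightarrow> complex poly" where
  "opuc \<alpha> 0 = 1"
| "opuc \<alpha> (Suc n) = [:0, 1:] * opuc \<alpha> n - smult (cnj (\<alpha> n)) (szego_rev n (opuc \<alpha> n))"

definition popuc :: "(nat \<Rightarrow> complex) \<Rightarrow> complex \<Rightarrow> nat \<Rightarrow> complex poly" where
  "popuc \<alpha> \<beta> n =
     [:0, 1:] * opuc \<alpha> (n - 1) - smult (cnj \<beta>) (szego_rev (n - 1) (opuc \<alpha> (n - 1)))"

(* zeta 1, ..., zeta n is the complete list of the distinct zeros of p, ordered by the argument
   Arg2pi, which takes values in [0, 2 pi). *)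
definition zeros_ccw :: "complex poly \<Rightarrow> nat \<Rightarrow> (nat \<Rightarrow> complex) \<Rightarrow> bool" where
  "zeros_ccw p n \<zeta> \<longleftrightarrow>
     bij_betw \<zeta> {1..n} {z. poly p z = 0} \<and> strict_mono_on {1..n} (\<lambda>j. Arg2pi (\<zeta> j))"

definition P_region :: "complex \<Rightarrow> complex set" where
  "P_region a = {z \<in> ball 0 1. Re z \<le> Re a}"

(* Value at the closest integer. For the arguments n - k * sqrt n used below there are no ties:
   k * sqrt n = sqrt (k^2 * n) is an integer or irrational. *)
definition at_nearest :: "(nat \<Rightarrow> real) \<Rightarrow> real \<Rightarrow> real" where
  "at_nearest f x = f (nat (round x))"

definition power_decay :: "(nat \<Rightarrow> real) \<Rightarrow> real \<Rightarrow> real \<Rightarrow> bool" where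
  "power_decay f C b \<longleftrightarrow>
     0 < C \<and> 0 < b \<and> b < 1 \<and> (\<forall>n\<ge>1. f n = - C * real n powr (- b))"

(* Only the values of f at positive integers are relevant. *)
definition slow_decay :: "(nat \<Rightarrow> complex) \<Rightarrow> (nat \<Rightarrow> real) \<Rightarrow> bool" where
  "slow_decay \<alpha> f \<longleftrightarrow>
     verblunsky \<alpha> \<and>
     (\<forall>n\<ge>1. f n \<le> 0) \<and>
     ((\<exists>C b. power_decay f C b) \<or>
      filterlim (\<lambda>n. sqrt (real n) * (at_nearest f (real n - sqrt (real n)))\<^sup>2) at_top sequentially) \<and>
     ((\<forall>n\<ge>1. f n < f (Suc n) \<and> f (Suc n) < 0) \<and> f \<longlonglongrightarrow> 0) \<and>
     (\<forall>k::nat. (\<lambda>n. at_nearest f (real n - real k * sqrt (real n)) / f n) \<longlonglongrightarrow> 1) \<and>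
     (\<lambda>n. \<alpha> n / complex_of_real (f n)) \<longlonglongrightarrow> 1 \<and>
     (\<exists>m0. \<forall>m\<ge>m0. \<forall>n\<le>m. Re (\<alpha> n) \<le> f m)"

(* t_M; the exponent b is determined by f, see decay_scale_power. *)
definition decay_scale :: "(nat \<Rightarrow> real) \<Rightarrow> nat \<Rightarrow> real" where
  "decay_scale f M =
     (if \<exists>C b. power_decay f C b
      then real M powr ((1 + (THE b. \<exists>C. power_decay f C b)) / 2)
      else sqrt (real M))"

lemma power_decay_unique:
  assumes "power_decay f C b" "power_decay f C' b'"
  shows "C = C'" "b = b'"
proof -
  from assms have "f 1 = - C" "f 1 = - C'" by (auto simp: power_decay_def)
  then show C: "C = C'" by simp
  have "f 2 = - C * 2 powr (- b)" "f 2 = - C' * 2 powr (- b')" "C > 0"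
    using assms unfolding power_decay_def by (metis of_nat_numeral one_le_numeral)+
  with C have "2 powr (- b) = (2::real) powr (- b')" by simp
  then show "b = b'" by (simp add: powr_inj)
qed

lemma decay_scale_power:
  assumes "power_decay f C b"
  shows "decay_scale f M = real M powr ((1 + b) / 2)"
proof -
  have "(THE b. \<exists>C. power_decay f C b) = b"
    using assms by (blast intro: the_equality dest: power_decay_unique)
  then show ?thesis using assms by (auto simp: decay_scale_def)
qed

lemma coeff_szego_rev: "coeff (szego_rev n p) i = (if i \<le> n then cnj (coeff p (n - i)) else 0)"
  by (simp add: szego_rev_def coeff_sum if_distrib cong: if_cong)

lemma poly_szego_rev:
  assumes "degree p \<le> n" "z \<noteq> 0"
  shows "poly (szego_rev n p) z = z ^ n * cnj (poly p (1 / cnj z))"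
proof -
  have "poly p (1 / cnj z) = (\<Sum>i\<le>n. coeff p i * (1 / cnj z) ^ i)"
    using assms(1) by (simp add: poly_altdef) (rule sum.mono_neutral_left, auto simp: coeff_eq_0)
  then have "z ^ n * cnj (poly p (1 / cnj z)) = (\<Sum>i\<le>n. cnj (coeff p i) * (z ^ n * (1 / z) ^ i))"
    by (simp add: sum_distrib_left mult_ac)
  also have "\<dots> = (\<Sum>i\<le>n. cnj (coeff p i) * z ^ (n - i))"
    using assms by (intro sum.cong refl) (simp add: power_diff power_one_over)
  also have "\<dots> = (\<Sum>i\<le>n. cnj (coeff p (n - i)) * z ^ i)"
    by (rule sum.reindex_bij_witness[of _ "\<lambda>i. n - i" "\<lambda>i. n - i"]) auto
  finally show ?thesis by (simp add: szego_rev_def poly_sum poly_monom)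
qed

lemma degree_szego_rev: "degree (szego_rev n p) \<le> n"
  by (rule degree_le) (simp add: coeff_szego_rev)

lemma opuc_monic: "degree (opuc \<alpha> n) = n \<and> coeff (opuc \<alpha> n) n = 1"
proof (induction n)
  case (Suc n)
  have c: "coeff (opuc \<alpha> (Suc n)) (Suc n) = 1"
    using Suc by (simp add: coeff_szego_rev)
  have "degree (opuc \<alpha> (Suc n)) \<le> Suc n"
    by (rule degree_le) (use Suc in \<open>auto simp: coeff_szego_rev coeff_pCons coeff_eq_0 split: nat.splits\<close>)
  with c show ?case by (metis le_antisym le_degree zero_neq_one)
qed simp

lemma degree_popuc:
  assumes "n \<ge> 1"
  shows "degree (popuc \<alpha> \<beta> n) = n"
proof -
  obtain m where n: "n = Suc m" using assms by (cases n) auto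
  have c: "coeff (popuc \<alpha> \<beta> n) n = 1"
    using opuc_monic[of \<alpha> m] by (simp add: n popuc_def coeff_szego_rev)
  have "degree (popuc \<alpha> \<beta> n) \<le> n"
    by (rule degree_le)
      (use opuc_monic[of \<alpha> m] in \<open>auto simp: n popuc_def coeff_szego_rev coeff_pCons coeff_eq_0 split: nat.splits\<close>)
  with c show ?thesis by (metis le_antisym le_degree zero_neq_one)
qed

lemma szego_rev_opuc_Suc:
  "szego_rev (Suc n) (opuc \<alpha> (Suc n)) = szego_rev n (opuc \<alpha> n) - smult (\<alpha> n) ([:0, 1:] * opuc \<alpha> n)"
proof (rule poly_eqI)
  fix i
  show "coeff (szego_rev (Suc n) (opuc \<alpha> (Suc n))) i =
        coeff (szego_rev n (opuc \<alpha> n) - smult (\<alpha> n) ([:0, 1:] * opuc \<alpha> n)) i"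
  proof (cases i)
    case 0
    then show ?thesis using opuc_monic[of \<alpha> n] by (auto simp: coeff_szego_rev)
  next
    case (Suc j)
    have "n - (n - j) = j" if "j \<le> n" using that by simp
    moreover have "coeff (pCons 0 (opuc \<alpha> n)) (n - j) = (if j < n then coeff (opuc \<alpha> n) (n - Suc j) else 0)"
      by (auto simp: coeff_pCons split: nat.splits) (metis diff_Suc diff_Suc_Suc nat.case(2))
    ultimately show ?thesis using Suc opuc_monic[of \<alpha> n]
      by (auto simp: coeff_szego_rev coeff_eq_0)
  qed
qed

lemma cmod_szego_identity:
  "(cmod (b - a * x))\<^sup>2 - (cmod (x - cnj a * b))\<^sup>2 = (1 - (cmod a)\<^sup>2) * ((cmod b)\<^sup>2 - (cmod x)\<^sup>2)"
  unfolding cmod_power2 by (simp add: power2_eq_square algebra_simps)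

lemma opuc_gap:
  assumes "verblunsky \<alpha>"
  shows "\<exists>c>0. \<forall>z. (cmod z \<le> 1 \<longrightarrow>
           (cmod (poly (szego_rev n (opuc \<alpha> n)) z))\<^sup>2 - (cmod (z * poly (opuc \<alpha> n) z))\<^sup>2 \<ge> c * (1 - (cmod z)\<^sup>2)) \<and>
         (cmod z \<ge> 1 \<longrightarrow>
           (cmod (z * poly (opuc \<alpha> n) z))\<^sup>2 - (cmod (poly (szego_rev n (opuc \<alpha> n)) z))\<^sup>2 \<ge> c * ((cmod z)\<^sup>2 - 1))"
proof (induction n)
  case 0
  show ?case by (intro exI[of _ 1]) (simp add: szego_rev_def)
next
  case (Suc n)
  then obtain c where c: "c > 0" and
    lo: "\<And>z. cmod z \<le> 1 \<Longrightarrow> (cmod (poly (szego_rev n (opuc \<alpha> n)) z))\<^sup>2 - (cmod (z * poly (opuc \<alpha> n) z))\<^sup>2 \<ge> c * (1 - (cmod z)\<^sup>2)" and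
    hi: "\<And>z. cmod z \<ge> 1 \<Longrightarrow> (cmod (z * poly (opuc \<alpha> n) z))\<^sup>2 - (cmod (poly (szego_rev n (opuc \<alpha> n)) z))\<^sup>2 \<ge> c * ((cmod z)\<^sup>2 - 1)"
    by blast
  define r where "r = 1 - (cmod (\<alpha> n))\<^sup>2"
  have r: "r > 0" using assms by (simp add: r_def verblunsky_def abs_square_less_1)
  show ?case
  proof (intro exI[of _ "r * c"] conjI allI impI)
    show "0 < r * c" using r c by simp
  next
    fix z :: complex
    define A where "A = poly (opuc \<alpha> n) z"
    define B where "B = poly (szego_rev n (opuc \<alpha> n)) z"
    define A' where "A' = poly (opuc \<alpha> (Suc n)) z"
    define B' where "B' = poly (szego_rev (Suc n) (opuc \<alpha> (Suc n))) z"
    have "A' = z * A - cnj (\<alpha> n) * B" by (simp add: A'_def A_def B_def)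
    moreover have "B' = B - \<alpha> n * (z * A)" by (simp add: B'_def A_def B_def szego_rev_opuc_Suc del: opuc.simps)
    ultimately have key: "(cmod B')\<^sup>2 - (cmod A')\<^sup>2 = r * ((cmod B)\<^sup>2 - (cmod (z * A))\<^sup>2)"
      unfolding r_def using cmod_szego_identity[of B "\<alpha> n" "z * A"] by simp
    have e: "(cmod (z * A'))\<^sup>2 = (cmod A')\<^sup>2 + ((cmod z)\<^sup>2 - 1) * (cmod A')\<^sup>2"
      by (simp add: norm_mult power_mult_distrib algebra_simps)
    {
      assume z: "cmod z \<le> 1"
      have "((cmod z)\<^sup>2 - 1) * (cmod A')\<^sup>2 \<le> 0"
        using z by (intro mult_nonpos_nonneg) (auto simp: abs_square_le_1)
      moreover have "r * c * (1 - (cmod z)\<^sup>2) \<le> r * ((cmod B)\<^sup>2 - (cmod (z * A))\<^sup>2)"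
        using lo[OF z] r by (simp add: A_def B_def mult.assoc)
      ultimately show "r * c * (1 - (cmod z)\<^sup>2) \<le> (cmod B')\<^sup>2 - (cmod (z * A'))\<^sup>2"
        using key e by linarith
    }
    {
      assume z: "cmod z \<ge> 1"
      have "((cmod z)\<^sup>2 - 1) * (cmod A')\<^sup>2 \<ge> 0"
        using z by (intro mult_nonneg_nonneg) auto
      moreover have "r * (c * ((cmod z)\<^sup>2 - 1)) \<le> r * ((cmod (z * A))\<^sup>2 - (cmod B)\<^sup>2)"
        using hi[OF z] r by (intro mult_left_mono) (auto simp: A_def B_def)
      moreover have "r * ((cmod (z * A))\<^sup>2 - (cmod B)\<^sup>2) = (cmod A')\<^sup>2 - (cmod B')\<^sup>2"
        using key by (simp add: algebra_simps)
      ultimately show "r * c * ((cmod z)\<^sup>2 - 1) \<le> (cmod (z * A'))\<^sup>2 - (cmod B')\<^sup>2"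
        using e by (simp add: mult.assoc)
    }
  qed
qed

lemma popuc_zeros_unit_circle:
  assumes "verblunsky \<alpha>" "cmod \<beta> = 1" "poly (popuc \<alpha> \<beta> n) z = 0"
  shows "cmod z = 1"
proof -
  define A where "A = poly (opuc \<alpha> (n - 1)) z"
  define B where "B = poly (szego_rev (n - 1) (opuc \<alpha> (n - 1))) z"
  have "z * A = cnj \<beta> * B" using assms(3) by (simp add: popuc_def A_def B_def)
  then have "cmod (z * A) = cmod B" using assms(2) by (simp add: norm_mult)
  with opuc_gap[OF assms(1), of "n - 1"] obtain c where "c > 0"
    "cmod z \<le> 1 \<longrightarrow> c * (1 - (cmod z)\<^sup>2) \<le> 0" "cmod z \<ge> 1 \<longrightarrow> c * ((cmod z)\<^sup>2 - 1) \<le> 0"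
    unfolding A_def B_def by fastforce
  then have "(cmod z)\<^sup>2 = 1"
    by (smt (verit) mult_pos_pos norm_ge_zero one_le_power power_le_one)
  then show ?thesis by (simp add: power2_eq_1_iff) (use norm_ge_zero[of z] in linarith)
qed

lemma popuc_rsquarefree:
  assumes v: "verblunsky \<alpha>" and \<beta>: "cmod \<beta> = 1" and n: "n \<ge> 1"
  shows "rsquarefree (popuc \<alpha> \<beta> n)"
  unfolding rsquarefree_def
proof (intro conjI allI)
  show nz: "popuc \<alpha> \<beta> n \<noteq> 0" using degree_popuc[OF n, of \<alpha> \<beta>] n by auto
  fix z0
  define A where "A = poly (opuc \<alpha> (n - 1))"
  define B where "B = poly (szego_rev (n - 1) (opuc \<alpha> (n - 1)))"
  have p: "poly (popuc \<alpha> \<beta> n) z = z * A z - cnj \<beta> * B z" for z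
    by (simp add: popuc_def A_def B_def)
  obtain c where c: "c > 0" and
    gap: "\<And>z. cmod z \<le> 1 \<Longrightarrow> c * (1 - (cmod z)\<^sup>2) \<le> (cmod (B z))\<^sup>2 - (cmod (z * A z))\<^sup>2"
    using opuc_gap[OF v, of "n - 1"] unfolding A_def B_def by blast
  show "order z0 (popuc \<alpha> \<beta> n) = 0 \<or> order z0 (popuc \<alpha> \<beta> n) = 1"
  proof (rule ccontr)
    assume "\<not> ?thesis"
    then have ord: "2 \<le> order z0 (popuc \<alpha> \<beta> n)" by linarith
    then have "[:- z0, 1:] ^ 2 dvd popuc \<alpha> \<beta> n" by (rule order_divides[THEN iffD2, OF disjI2])
    then obtain q where q: "popuc \<alpha> \<beta> n = [:- z0, 1:] ^ 2 * q" by blast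
    have z0: "cmod z0 = 1"
      by (rule popuc_zeros_unit_circle[OF v \<beta>, of n]) (simp add: q)
    define K where "K = (\<lambda>z. cmod (poly q z) * (cmod (B z) + cmod (z * A z)))"
    have "compact (K ` cball 0 1)"
      by (intro compact_continuous_image) (auto simp: K_def A_def B_def intro!: continuous_intros)
    then obtain L where L: "\<And>z. cmod z \<le> 1 \<Longrightarrow> \<bar>K z\<bar> \<le> L"
      by (force dest!: compact_imp_bounded simp: bounded_iff)
    have L0: "L \<ge> 0" using L[of 0] by simp
    have step: "c \<le> s * L" if s: "0 < s" "s < 1" for s :: real
    proof -
      define z where "z = of_real (1 - s) * z0"
      have cz: "cmod z = 1 - s" using s z0 by (simp only: z_def norm_mult norm_of_real) simp
      have "z - z0 = - (of_real s * z0)" by (simp add: z_def algebra_simps)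
      then have d: "cmod (z - z0) = s" using s z0 by (simp add: norm_mult)
      have "cmod (poly (popuc \<alpha> \<beta> n) z) = s\<^sup>2 * cmod (poly q z)"
        using d by (simp add: q norm_mult norm_power)
      moreover have "cmod (B z) - cmod (z * A z) \<le> cmod (poly (popuc \<alpha> \<beta> n) z)"
        using norm_triangle_ineq2[of "cnj \<beta> * B z" "z * A z"] \<beta>
        by (simp add: p norm_mult norm_minus_commute)
      ultimately have m: "cmod (B z) - cmod (z * A z) \<le> s\<^sup>2 * cmod (poly q z)" by simp
      have "c * s \<le> c * (1 - (cmod z)\<^sup>2)"
        using c s by (intro mult_left_mono) (auto simp: cz power2_eq_square algebra_simps mult_left_le)
      also have "\<dots> \<le> (cmod (B z))\<^sup>2 - (cmod (z * A z))\<^sup>2"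
        using s by (intro gap) (simp add: cz)
      also have "\<dots> = (cmod (B z) - cmod (z * A z)) * (cmod (B z) + cmod (z * A z))"
        by (simp add: power2_eq_square algebra_simps)
      also have "\<dots> \<le> s\<^sup>2 * cmod (poly q z) * (cmod (B z) + cmod (z * A z))"
        by (intro mult_right_mono m) auto
      also have "\<dots> \<le> s\<^sup>2 * L"
        using L[of z] s by (simp add: cz K_def mult.assoc)
      finally show ?thesis using s by (simp add: power2_eq_square mult.commute)
    qed
    define s where "s = min (1 / 2) (c / (2 * (L + 1)))"
    have s: "0 < s" "s < 1" using c L0 by (auto simp: s_def)
    have "s * L \<le> s * (L + 1)" using s by simp
    also have "\<dots> \<le> c / (2 * (L + 1)) * (L + 1)"
      using L0 by (intro mult_right_mono) (auto simp: s_def)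
    also have "\<dots> = c / 2" using L0 by (simp add: field_simps)
    also have "\<dots> < c" using c by simp
    finally show False using step[OF s] by simp
  qed
qed

lemma zeros_ccw_popuc_exists:
  assumes v: "verblunsky \<alpha>" and \<beta>: "cmod \<beta> = 1" and n: "n \<ge> 1"
  shows "\<exists>\<zeta>. zeros_ccw (popuc \<alpha> \<beta> n) n \<zeta>"
proof -
  define p where "p = popuc \<alpha> \<beta> n"
  define Z where "Z = {z. poly p z = 0}"
  have nz: "p \<noteq> 0" using degree_popuc[OF n, of \<alpha> \<beta>] n by (auto simp: p_def)
  have fin: "finite Z" unfolding Z_def by (rule poly_roots_finite[OF nz])
  have "p = smult (lead_coeff p) (\<Prod>z\<in>Z. [:- z, 1:])"
    using complex_poly_decompose_rsquarefree[of p] popuc_rsquarefree[OF v \<beta> n]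
    by (simp add: Z_def p_def)
  then have "degree p = degree (\<Prod>z\<in>Z. [:- z, 1:])"
    using nz by (metis degree_smult_eq leading_coeff_0_iff)
  also have "\<dots> = card Z" by (subst degree_prod_eq_sum_degree) auto
  finally have card: "card Z = n" using degree_popuc[OF n] by (simp add: p_def)
  have inj: "inj_on Arg2pi Z"
  proof (rule inj_onI)
    fix x y assume "x \<in> Z" "y \<in> Z" and a: "Arg2pi x = Arg2pi y"
    then have "cmod x = 1" "cmod y = 1"
      using popuc_zeros_unit_circle[OF v \<beta>] by (auto simp: Z_def p_def)
    with a show "x = y" by (metis complex_norm_eq_1_exp)
  qed
  define l where "l = sorted_list_of_set (Arg2pi ` Z)"
  have l: "length l = n" "set l = Arg2pi ` Z" "sorted_wrt (<) l" "distinct l"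
    using fin card inj by (auto simp: l_def card_image)
  define \<zeta> where "\<zeta> = (\<lambda>j. the_inv_into Z Arg2pi (l ! (j - 1)))"
  have "bij_betw (\<lambda>j. j - 1) {1..n} {..<n}"
    by (rule bij_betwI[of _ _ _ Suc]) auto
  moreover have "bij_betw ((!) l) {..<n} (Arg2pi ` Z)"
    using l by (intro bij_betw_nth) auto
  moreover have "bij_betw (the_inv_into Z Arg2pi) (Arg2pi ` Z) Z"
    using inj by (simp add: bij_betw_the_inv_into inj_on_imp_bij_betw)
  ultimately have "bij_betw (the_inv_into Z Arg2pi \<circ> ((!) l \<circ> (\<lambda>j. j - 1))) {1..n} Z"
    by (meson bij_betw_trans)
  moreover have "the_inv_into Z Arg2pi \<circ> ((!) l \<circ> (\<lambda>j. j - 1)) = \<zeta>"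
    by (auto simp: \<zeta>_def)
  ultimately have "bij_betw \<zeta> {1..n} Z" by simp
  moreover have "strict_mono_on {1..n} (\<lambda>j. Arg2pi (\<zeta> j))"
  proof (rule strict_mono_onI)
    fix i j assume ij: "i \<in> {1..n}" "j \<in> {1..n}" "i < j"
    have "Arg2pi (\<zeta> m) = l ! (m - 1)" if "m \<in> {1..n}" for m
      unfolding \<zeta>_def using that l(1) nth_mem[of "m - 1" l]
      by (intro f_the_inv_into_f inj) (auto simp: l(2))
    moreover have "l ! (i - 1) < l ! (j - 1)"
      using ij l by (intro sorted_wrt_nth_less[OF l(3)]) auto
    ultimately show "Arg2pi (\<zeta> i) < Arg2pi (\<zeta> j)" using ij by simp
  qed
  ultimately show ?thesis unfolding zeros_ccw_def Z_def p_def by blast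
qed

end

theory Submission
  imports Defs
begin

text \<open>On the unit circle the quotient $z\Phi_n(z)/\Phi_n^*(z)$ is unimodular, and the Szego recursion
moves it by a Moebius map of the circle followed by the rotation by $z$. Lifted to the real line,
with $z = e^{i\theta}$, it becomes the Pruefer phase $\eta_n(\theta)$, where
$\eta_{n+1} = \theta + g_{\alpha_n}(\eta_n)$ and
$g_\alpha(\eta) = \eta - 2 \arg(1 - \alpha e^{i\eta})$. The paraorthogonal polynomial of degree $M$
vanishes at $e^{i\theta}$ exactly when $\eta_{M-1}(\theta) \in -\xi + 2\pi\mathbb{Z}$
(\<open>popuc_zero_iff_phase\<close>), and the phase is continuous and increasing in $\theta$.
The zeros closest to $1$ sit where the recursion changes from trapped to rotating, and that happens
near $\theta = 2|f(M)|$.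

Below that angle the phase is trapped. Put $\alpha_M = -a$. All coefficients used have real part
at most $-a = -\cos\phi$, and for $0 \le \theta \le 2a$ the interval $[-\phi, \phi + \theta]$ is
mapped into itself by every step (\<open>pruefer_phase_confined\<close>). The invariant interval stays clear of
the points $-\xi + 2\pi\mathbb{Z}$, because $e^{-i\xi}$ lies in the left half plane at angular distance
at least $\epsilon$ from the imaginary axis. Hence no zero has an argument in $[0, 2a]$
(\<open>popuc_zero_free_arc\<close>), and $a$ is asymptotic to $|f(M)|$.

Slightly above that angle, at $\theta = 2|f(M)|(1 + \delta/2)$, the phase rotates. On the last
$t_M$ steps the coefficients have modulus at most $(1 + \delta/8)|f(M)|$, so every step advances the
phase by at least $|f(M)|\delta/2$. The slow decay of $f$ makes $t_M|f(M)|$ tend to infinity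
(\<open>slow_decay_window\<close>), so the phase gains any prescribed number of turns over these steps. At their start it is at
least $\eta(0) \ge -\pi/2$ by monotonicity, whereas $\eta_{M-1}(0) \le \pi/2$. The intermediate value
theorem in $\theta$ then yields $k$ zeros in the arc from $1$ to $e^{i\theta}$
(\<open>kth_zero_le_if_phase_winds\<close>). The block of $t_M$ prescribed coefficients supplied by
$N = 1$ is already long enough.\<close>

section \<open>The Pruefer phase\<close>

primrec pruefer_phase :: "(nat \<Rightarrow> complex) \<Rightarrow> real \<Rightarrow> nat \<Rightarrow> real" where
  "pruefer_phase \<alpha> \<theta> 0 = \<theta>"
| "pruefer_phase \<alpha> \<theta> (Suc n) =
     \<theta> + (pruefer_phase \<alpha> \<theta> n - 2 * Arg (1 - \<alpha> n * cis (pruefer_phase \<alpha> \<theta> n)))"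

lemma one_minus_nonzero:
  fixes u :: complex
  assumes "cmod u < 1" shows "1 - u \<noteq> 0"
  using assms by auto

lemma Re_one_minus_pos:
  assumes "cmod u < 1" shows "Re (1 - u) > 0"
  using complex_Re_le_cmod[of u] assms by simp

lemma cmod_mult_cis: "cmod (a * cis x) = cmod a"
  by (simp add: norm_mult)

text \<open>With $w = 1 - a e^{ix}$ one has $e^{ix}\overline{w} = e^{ix} - \overline{a}$, and
$\overline{w}/w = e^{-2i \arg w}$; so the phase step is the Moebius map
$B \mapsto (B - \overline{a})/(1 - aB)$ on the circle.\<close>

lemma cis_phase_step:
  assumes "cmod a < 1"
  shows "cis (x - 2 * Arg (1 - a * cis x)) * (1 - a * cis x) = cis x - cnj a"
proof -
  define w where "w = 1 - a * cis x"
  have "w \<noteq> 0" using one_minus_nonzero[of "a * cis x"] assms by (simp add: w_def cmod_mult_cis)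
  then have w: "w = cmod w * cis (Arg w)" by (simp add: cis_Arg complex_sgn_def scaleR_conv_of_real)
  have "cis (x - 2 * Arg w) * w = cmod w * (cis (x - 2 * Arg w) * cis (Arg w))"
    by (subst (2) w) (simp add: mult_ac)
  also have "\<dots> = cmod w * (cis x * cis (- Arg w))" by (simp add: cis_mult)
  also have "\<dots> = cis x * cnj w" by (subst (3) w) (simp add: cis_cnj)
  also have "\<dots> = cis x - cnj a * (cis x * cis (- x))"
    by (simp add: w_def algebra_simps cis_cnj)
  also have "\<dots> = cis x - cnj a" by (simp add: cis_mult)
  finally show ?thesis by (simp add: w_def)
qed

text \<open>The two parts of the Szego recursion have the quotient computed in \<open>cis_phase_step\<close>. The
nonvanishing of $\Phi_n^*$ is carried along because each step multiplies it by
$1 - \alpha_n e^{i\eta_n} \ne 0$; it is what turns zeros into conditions on the phase alone.\<close>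

lemma opuc_eq_phase:
  assumes "verblunsky \<alpha>"
  shows "cis \<theta> * poly (opuc \<alpha> n) (cis \<theta>) =
           cis (pruefer_phase \<alpha> \<theta> n) * poly (szego_rev n (opuc \<alpha> n)) (cis \<theta>)
         \<and> poly (szego_rev n (opuc \<alpha> n)) (cis \<theta>) \<noteq> 0"
proof (induction n)
  case 0
  show ?case by (simp add: szego_rev_def)
next
  case (Suc n)
  define A where "A = poly (opuc \<alpha> n) (cis \<theta>)"
  define B where "B = poly (szego_rev n (opuc \<alpha> n)) (cis \<theta>)"
  define x where "x = pruefer_phase \<alpha> \<theta> n"
  have a: "cmod (\<alpha> n) < 1" using assms by (simp add: verblunsky_def)
  have IH: "cis \<theta> * A = cis x * B" "B \<noteq> 0" using Suc by (auto simp: A_def B_def x_def)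
  have w: "1 - \<alpha> n * cis x \<noteq> 0"
    using one_minus_nonzero[of "\<alpha> n * cis x"] a by (simp add: cmod_mult_cis)
  have A': "poly (opuc \<alpha> (Suc n)) (cis \<theta>) = (cis x - cnj (\<alpha> n)) * B"
    using IH by (simp add: A_def B_def algebra_simps)
  have "poly (szego_rev (Suc n) (opuc \<alpha> (Suc n))) (cis \<theta>) = B - \<alpha> n * (cis \<theta> * A)"
    by (simp add: A_def B_def szego_rev_opuc_Suc del: opuc.simps)
  then have B': "poly (szego_rev (Suc n) (opuc \<alpha> (Suc n))) (cis \<theta>) = (1 - \<alpha> n * cis x) * B"
    by (simp only: IH(1)) (simp add: algebra_simps)
  have "cis (pruefer_phase \<alpha> \<theta> (Suc n)) = cis \<theta> * cis (x - 2 * Arg (1 - \<alpha> n * cis x))"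
    by (simp add: x_def cis_mult)
  then have "cis (pruefer_phase \<alpha> \<theta> (Suc n)) * (1 - \<alpha> n * cis x) = cis \<theta> * (cis x - cnj (\<alpha> n))"
    by (simp only: mult.assoc cis_phase_step[OF a])
  then have "cis \<theta> * ((cis x - cnj (\<alpha> n)) * B) =
      cis (pruefer_phase \<alpha> \<theta> (Suc n)) * ((1 - \<alpha> n * cis x) * B)"
    by (metis mult.assoc)
  then show ?case unfolding A' B' using w IH(2) by simp
qed

lemma popuc_zero_iff_phase:
  assumes "verblunsky \<alpha>"
  shows "poly (popuc \<alpha> \<beta> n) (cis \<theta>) = 0 \<longleftrightarrow> cis (pruefer_phase \<alpha> \<theta> (n - 1)) = cnj \<beta>"
  using opuc_eq_phase[OF assms, of \<theta> "n - 1"] by (simp add: popuc_def)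

text \<open>With $u = a e^{ix}$ the derivative is $1 + 2\,\mathrm{Re}\,(u/(1-u)) = \mathrm{Re}\,((1+u)/(1-u))$, the
Poisson kernel, hence positive. This gives monotonicity and continuity of the phase.\<close>

lemma phase_step_has_derivative:
  assumes "cmod a < 1"
  shows "((\<lambda>x. x - 2 * Arg (1 - a * cis x)) has_real_derivative
            (1 - (cmod a)\<^sup>2) / (cmod (1 - a * cis x))\<^sup>2) (at x)"
proof -
  define w where "w = (\<lambda>x. 1 - a * cis x)"
  have pos: "Re (w x) > 0" for x
    using Re_one_minus_pos[of "a * cis x"] assms by (auto simp: w_def cmod_mult_cis)
  then have nz: "w x \<noteq> 0" for x by (metis less_irrefl zero_complex.sel(1))
  \<comment> \<open>The values of $w$ stay in the right half plane, where $\arg w$ is the imaginary part of the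
    holomorphic function $\log w$.\<close>
  have "w x \<notin> \<real>\<^sub>\<le>\<^sub>0" using pos[of x] by (auto elim!: nonpos_Reals_cases)
  then have "((\<lambda>x. Ln (1 - a * exp (\<i> * x))) has_field_derivative - a * (\<i> * cis x) * (1 / w x))
      (at (of_real x))"
    by (auto intro!: derivative_eq_intros simp: w_def cis_conv_exp divide_inverse)
  then have "((\<lambda>x. Ln (w x)) has_vector_derivative - a * (\<i> * cis x) * (1 / w x)) (at x)"
    unfolding w_def cis_conv_exp by (rule has_vector_derivative_real_field)
  then have "((\<lambda>x. Im (Ln (w x))) has_vector_derivative Im (- a * (\<i> * cis x) * (1 / w x))) (at x)"
    by (rule bounded_linear.has_vector_derivative[OF bounded_linear_Im])
  moreover have "(\<lambda>x. Im (Ln (w x))) = (\<lambda>x. Arg (w x))" using nz by (auto simp: Arg_eq_Im_Ln)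
  ultimately have "((\<lambda>x. Arg (w x)) has_real_derivative Im (- a * (\<i> * cis x) * (1 / w x))) (at x)"
    by (simp add: has_real_derivative_iff_has_vector_derivative)
  then have d: "((\<lambda>x. x - 2 * Arg (w x)) has_real_derivative
      1 - 2 * Im (- a * (\<i> * cis x) * (1 / w x))) (at x)"
    by (auto intro!: derivative_eq_intros)
  define u where "u = a * cis x"
  have u: "cmod u = cmod a" by (simp add: u_def cmod_mult_cis)
  have "1 - 2 * Im (- a * (\<i> * cis x) * (1 / w x)) = 1 + 2 * Re (u / (1 - u))"
    using Im_i_times[of "u / (1 - u)"] by (simp add: u_def w_def mult_ac)
  also have "\<dots> = Re (1 + 2 * (u / (1 - u)))"
    by (simp only: plus_complex.sel one_complex.sel mult_2)
  also have "1 + 2 * (u / (1 - u)) = (1 + u) / (1 - u)"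
    using nz[of x] by (simp add: u_def w_def field_simps)
  also have "Re ((1 + u) / (1 - u)) = Re ((1 + u) * cnj (1 - u) / complex_of_real ((cmod (1 - u))\<^sup>2))"
    by (subst complex_div_cnj) simp
  also have "\<dots> = Re ((1 + u) * cnj (1 - u)) / (cmod (1 - u))\<^sup>2"
    by (rule Re_divide_of_real)
  also have "Re ((1 + u) * cnj (1 - u)) = 1 - (cmod u)\<^sup>2"
    unfolding cmod_power2 by (simp add: algebra_simps power2_eq_square)
  finally show ?thesis using d by (simp add: u w_def u_def cmod_mult_cis)
qed

lemma phase_step_mono:
  assumes "cmod a < 1" "x \<le> y"
  shows "x - 2 * Arg (1 - a * cis x) \<le> y - 2 * Arg (1 - a * cis y)"
proof (rule DERIV_nonneg_imp_nondecreasing[OF assms(2)])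
  fix z
  have "0 \<le> (1 - (cmod a)\<^sup>2) / (cmod (1 - a * cis z))\<^sup>2"
    using assms(1) by (simp add: abs_square_le_1)
  then show "\<exists>D. ((\<lambda>x. x - 2 * Arg (1 - a * cis x)) has_real_derivative D) (at z) \<and> 0 \<le> D"
    using phase_step_has_derivative[OF assms(1)] by blast
qed

lemma pruefer_phase_mono:
  assumes "verblunsky \<alpha>" "\<theta> \<le> \<theta>'"
  shows "pruefer_phase \<alpha> \<theta> n \<le> pruefer_phase \<alpha> \<theta>' n"
proof (induction n)
  case (Suc n)
  have "cmod (\<alpha> n) < 1" using assms(1) by (simp add: verblunsky_def)
  from phase_step_mono[OF this Suc] show ?case using assms(2) by simp
qed (use assms in simp)

lemma continuous_on_pruefer_phase:
  assumes "verblunsky \<alpha>"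
  shows "continuous_on UNIV (\<lambda>\<theta>. pruefer_phase \<alpha> \<theta> n)"
proof (induction n)
  case (Suc n)
  have "cmod (\<alpha> n) < 1" using assms(1) by (simp add: verblunsky_def)
  from DERIV_isCont[OF phase_step_has_derivative[OF this]]
  have "continuous_on UNIV (\<lambda>x. x - 2 * Arg (1 - \<alpha> n * cis x))"
    by (simp add: continuous_at_imp_continuous_on)
  from continuous_on_compose2[OF this Suc] show ?case
    by (auto intro!: continuous_intros)
qed simp

section \<open>Confinement of the phase\<close>

lemma le_Arg_if_Im_nonneg:
  assumes "Re w > 0" "t \<le> pi / 2" "Im (w * cis (- t)) \<ge> 0"
  shows "t \<le> Arg w"
proof (rule ccontr)
  assume "\<not> t \<le> Arg w"
  moreover have "\<bar>Arg w\<bar> < pi / 2" using Arg_Re_pos[of w] assms(1) by blast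
  ultimately have "sin (t - Arg w) > 0" using assms(2) by (intro sin_gt_zero) auto
  have nz: "w \<noteq> 0" using assms(1) by auto
  then have w: "w = cmod w * cis (Arg w)" by (simp add: cis_Arg complex_sgn_def scaleR_conv_of_real)
  have "w * cis (- t) = cmod w * cis (Arg w - t)"
    by (subst w) (simp add: cis_mult)
  then have "Im (w * cis (- t)) = - (cmod w * sin (t - Arg w))"
    by (simp add: sin_diff algebra_simps)
  moreover have "cmod w * sin (t - Arg w) > 0"
    using nz \<open>sin (t - Arg w) > 0\<close> by simp
  ultimately show False using assms(3) by simp
qed

lemma abs_Im_le_sin:
  assumes "cmod a < 1" "Re a \<le> - cos \<phi>" "0 \<le> \<phi>" "\<phi> \<le> pi / 2"
  shows "\<bar>Im a\<bar> \<le> sin \<phi>"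
proof -
  have "0 \<le> cos \<phi>" using assms by (intro cos_ge_zero) auto
  then have "(cos \<phi>)\<^sup>2 \<le> (- Re a)\<^sup>2" using assms(2) by (intro power_mono) auto
  moreover have "(cmod a)\<^sup>2 \<le> 1" using assms(1) by (simp add: abs_square_le_1)
  ultimately have "(Im a)\<^sup>2 \<le> (sin \<phi>)\<^sup>2" using sin_cos_squared_add[of \<phi>]
    unfolding cmod_power2 power2_minus by linarith
  moreover have "0 \<le> sin \<phi>" using assms by (intro sin_ge_zero) auto
  ultimately show ?thesis using abs_le_square_iff[of "Im a" "sin \<phi>"] by simp
qed

text \<open>Since the step is increasing, it suffices to inspect the endpoints of $[-\phi, \phi + \theta]$. Write
$-a = x + iy$ with $x \ge \cos\phi$ and $|y| \le \sin\phi$: the point $-a$ lies in the circular cap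
with corners $e^{\pm i\phi}$. At the upper endpoint the step must turn back by at least $\theta$,
that is $\arg(1 - a e^{i(\phi+\theta)}) \ge \theta/2$; the cap rotated by $\phi + \theta$ and seen
from $-1$ has least angle at the corner $e^{i\theta}$, where the angle is exactly $\theta/2$. At the
lower endpoint the cap rotated by $-\phi$ has its highest corner at $1$, so the step does not decrease.
The bound $\phi + \theta/2 \le \pi/2$ keeps the cosine in the first estimate nonnegative.\<close>

lemma phase_step_confined:
  assumes a: "cmod a < 1" "Re a \<le> - cos \<phi>"
    and \<phi>: "0 \<le> \<phi>" and \<theta>: "0 \<le> \<theta>" "\<phi> + \<theta> / 2 \<le> pi / 2"
    and x: "- \<phi> \<le> x" "x \<le> \<phi> + \<theta>"
  shows "\<bar>x - 2 * Arg (1 - a * cis x)\<bar> \<le> \<phi>"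
proof -
  have pos: "Re (1 - a * cis y) > 0" for y
    using Re_one_minus_pos[of "a * cis y"] a by (auto simp: cmod_mult_cis)
  have im: "\<bar>Im a\<bar> \<le> sin \<phi>" using abs_Im_le_sin[OF a] \<phi> \<theta> by simp
  have c: "0 \<le> cos \<phi>" "0 \<le> cos (\<phi> + \<theta> / 2)" "0 \<le> sin \<phi>" "0 \<le> sin (\<phi> + \<theta> / 2)"
    using \<phi> \<theta> by (auto intro!: cos_ge_zero sin_ge_zero)
  have "\<theta> / 2 \<le> Arg (1 - a * cis (\<phi> + \<theta>))"
  proof (rule le_Arg_if_Im_nonneg[OF pos])
    have "(1 - a * cis (\<phi> + \<theta>)) * cis (- (\<theta> / 2)) = cis (- (\<theta> / 2)) - a * cis (\<phi> + \<theta> / 2)"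
      by (simp add: left_diff_distrib mult.assoc cis_mult add.commute)
    then have "Im ((1 - a * cis (\<phi> + \<theta>)) * cis (- (\<theta> / 2))) =
        - sin (\<theta> / 2) + ((- Re a) * sin (\<phi> + \<theta> / 2) - Im a * cos (\<phi> + \<theta> / 2))"
      by simp
    moreover have "cos \<phi> * sin (\<phi> + \<theta> / 2) \<le> (- Re a) * sin (\<phi> + \<theta> / 2)"
      using a c by (intro mult_right_mono) auto
    moreover have "Im a * cos (\<phi> + \<theta> / 2) \<le> sin \<phi> * cos (\<phi> + \<theta> / 2)"
      using im c by (intro mult_right_mono) auto
    moreover have "sin (\<theta> / 2) = cos \<phi> * sin (\<phi> + \<theta> / 2) - sin \<phi> * cos (\<phi> + \<theta> / 2)"
      using sin_diff[of "\<phi> + \<theta> / 2" \<phi>] by (simp add: mult_ac)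
    ultimately show "0 \<le> Im ((1 - a * cis (\<phi> + \<theta>)) * cis (- (\<theta> / 2)))"
      by linarith
  qed (use \<phi> \<theta> in simp)
  moreover have "Arg (1 - a * cis (- \<phi>)) \<le> 0"
  proof -
    have "Im (1 - a * cis (- \<phi>)) = Re a * sin \<phi> - Im a * cos \<phi>" by simp
    moreover have "Re a * sin \<phi> \<le> - cos \<phi> * sin \<phi>"
      using a c by (intro mult_right_mono) auto
    moreover have "- Im a * cos \<phi> \<le> sin \<phi> * cos \<phi>"
      using im c by (intro mult_right_mono) auto
    ultimately have im: "Im (1 - a * cis (- \<phi>)) \<le> 0" by (simp add: mult.commute)
    show ?thesis using im pos[of "- \<phi>"]
      by (simp only: arg_conv_arctan) (auto simp: divide_nonpos_pos)
  qed
  ultimately show ?thesis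
    using phase_step_mono[OF a(1) x(1)] phase_step_mono[OF a(1) x(2)] by linarith
qed

lemma pruefer_phase_confined:
  assumes v: "verblunsky \<alpha>" and re: "\<And>n. n < m \<Longrightarrow> Re (\<alpha> n) \<le> - cos \<phi>"
    and \<phi>: "0 \<le> \<phi>" and \<theta>: "0 \<le> \<theta>" "\<phi> + \<theta> / 2 \<le> pi / 2"
  shows "- \<phi> \<le> pruefer_phase \<alpha> \<theta> m \<and> pruefer_phase \<alpha> \<theta> m \<le> \<phi> + \<theta>"
  using re
proof (induction m)
  case (Suc m)
  have "cmod (\<alpha> m) < 1" using v by (simp add: verblunsky_def)
  from phase_step_confined[OF this _ \<phi> \<theta>, of "pruefer_phase \<alpha> \<theta> m"] Suc \<theta>
  show ?case by fastforce
qed (use \<phi> \<theta> in auto)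

section \<open>Rotation of the phase\<close>

text \<open>A coefficient of modulus at most $R < 1$ turns the phase back by at most $2R/(1-R)$, since
$|\arg(1-u)| \le |\mathrm{Im}\,u|/\mathrm{Re}\,(1-u)$.\<close>

lemma pruefer_phase_growth:
  assumes v: "verblunsky \<alpha>" and R: "R < 1" "\<And>n. m \<le> n \<Longrightarrow> n < m + j \<Longrightarrow> cmod (\<alpha> n) \<le> R"
  shows "pruefer_phase \<alpha> \<theta> (m + j) \<ge> pruefer_phase \<alpha> \<theta> m + real j * (\<theta> - 2 * (R / (1 - R)))"
  using R(2)
proof (induction j)
  case (Suc j)
  define u where "u = \<alpha> (m + j) * cis (pruefer_phase \<alpha> \<theta> (m + j))"
  have u: "cmod u \<le> R" using Suc by (simp add: u_def cmod_mult_cis)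
  then have pos: "Re (1 - u) > 0" using R by (intro Re_one_minus_pos) auto
  have re: "1 - R \<le> Re (1 - u)" "- Im u \<le> R"
    using complex_Re_le_cmod[of u] abs_Im_le_cmod[of u] u by auto
  have "Arg (1 - u) = arctan (Im (1 - u) / Re (1 - u))" using pos by (simp add: arg_conv_arctan)
  also have "\<dots> \<le> \<bar>Im (1 - u) / Re (1 - u)\<bar>" by (metis abs_arctan_le abs_le_D1)
  also have "\<dots> = \<bar>Im u\<bar> / Re (1 - u)" using pos by (simp add: abs_divide)
  also have "\<dots> \<le> R / (1 - R)"
    using R re u abs_Im_le_cmod[of u] by (intro frac_le) auto
  finally have "Arg (1 - u) \<le> R / (1 - R)" .
  moreover have "pruefer_phase \<alpha> \<theta> (m + j) \<ge> pruefer_phase \<alpha> \<theta> m + real j * (\<theta> - 2 * (R / (1 - R)))"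
    using Suc by simp
  moreover have "pruefer_phase \<alpha> \<theta> (m + Suc j) = \<theta> + (pruefer_phase \<alpha> \<theta> (m + j) - 2 * Arg (1 - u))"
    by (simp add: u_def)
  moreover have "real (Suc j) * (\<theta> - 2 * (R / (1 - R))) = real j * (\<theta> - 2 * (R / (1 - R))) + (\<theta> - 2 * (R / (1 - R)))"
    by (simp add: distrib_right)
  ultimately show ?case by linarith
qed simp

section \<open>Locating the zeros\<close>

lemma cis_eq_cnj_exp_imp:
  assumes "cis y = cnj (exp (\<i> * complex_of_real \<xi>))"
  shows "\<exists>m::int. y + \<xi> = of_int m * 2 * pi"
proof -
  have "cis y = cis (- \<xi>)" using assms by (simp add: cis_cnj flip: cis_conv_exp)
  then have "cis (y + \<xi>) = 1" by (metis cis_mult cis_zero add.left_inverse)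
  then have "cos (y + \<xi>) = 1" by (metis cis.sel(1) one_complex.sel(1))
  then show ?thesis by (simp add: cos_one_2pi_int)
qed

text \<open>The trapping interval for $\phi = \arccos a$ is available as long as $\theta \le 2 \arcsin a$, in
particular for $\theta \le 2a$. It lies in $[-\pi/2, \pi/2 + a]$, which contains no
point of $-\xi + 2\pi\mathbb{Z}$ when $a < \epsilon$.\<close>

lemma popuc_zero_free_arc:
  assumes v: "verblunsky \<alpha>" and re: "\<And>n. n < M \<Longrightarrow> Re (\<alpha> n) \<le> - a"
    and a: "0 < a" "a < 1" "a < \<epsilon>"
    and \<xi>: "\<xi> \<in> {pi / 2 + \<epsilon> <..< 3 * pi / 2 - \<epsilon>}"
    and z: "poly (popuc \<alpha> (exp (\<i> * complex_of_real \<xi>)) M) z = 0"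
  shows "2 * a < Arg2pi z"
proof (rule ccontr)
  assume "\<not> 2 * a < Arg2pi z"
  then have le: "Arg2pi z \<le> 2 * a" by simp
  define \<theta> where "\<theta> = Arg2pi z"
  define \<phi> where "\<phi> = arccos a"
  have "cmod z = 1" using popuc_zeros_unit_circle[OF v _ z] by simp
  then have zc: "z = cis \<theta>" using complex_norm_eq_1_exp[of z] by (simp add: \<theta>_def cis_conv_exp)
  have \<theta>: "0 \<le> \<theta>" "\<theta> \<le> 2 * a" using le Arg2pi[of z] by (auto simp: \<theta>_def)
  have cos: "cos \<phi> = a" using a by (simp add: \<phi>_def)
  have \<phi>: "0 \<le> \<phi>" "\<phi> \<le> pi / 2"
    using a arccos_lbound[of a] arccos_le_pi2[of a] by (simp_all add: \<phi>_def)
  have "a = sin (arcsin a)" using a by simp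
  also have "\<dots> \<le> arcsin a" using a by (intro sin_x_le_x arcsin_nonneg) auto
  finally have "\<phi> + a \<le> pi / 2" using a by (simp add: \<phi>_def arccos_arcsin_eq)
  then have \<phi>\<theta>: "\<phi> + \<theta> / 2 \<le> pi / 2" using \<theta> by linarith
  define y where "y = pruefer_phase \<alpha> \<theta> (M - 1)"
  have y: "- \<phi> \<le> y" "y \<le> \<phi> + \<theta>"
    using pruefer_phase_confined[OF v _ \<phi>(1) \<theta>(1) \<phi>\<theta>, of "M - 1"] re
    by (auto simp: y_def cos)
  obtain m :: int where m: "y + \<xi> = of_int m * 2 * pi"
    using popuc_zero_iff_phase[OF v] z cis_eq_cnj_exp_imp unfolding y_def zc by blast
  \<comment> \<open>$y + \xi > -\pi/2 + \pi/2 + \epsilon$ and $y + \xi < \pi/2 + a + 3\pi/2 - \epsilon$\<close>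
  have "0 < y + \<xi>" "y + \<xi> < 2 * pi" using y \<xi> \<phi> \<phi>\<theta> \<theta> a by auto
  then have "0 < of_int m * 2 * pi" "of_int m * (2 * pi) < 1 * (2 * pi)" by (simp_all add: m)
  then have "0 < m" "m < 1" by (simp_all add: zero_less_mult_iff)
  then show False by simp
qed

lemma Arg2pi_cis: "0 \<le> t \<Longrightarrow> t < 2 * pi \<Longrightarrow> Arg2pi (cis t) = t"
  by (rule Arg2pi_unique[of 1]) (simp_all add: cis_conv_exp)

text \<open>Between the angles $0$ and $\theta$ the phase takes each of the values $2\pi j - \xi$, $1 \le j \le k$.
These give $k$ distinct zeros with argument at most $\theta$, and the first $k - 1$ zeros in the
ordering cannot account for all of them.\<close>

lemma kth_zero_le_if_phase_winds:
  assumes v: "verblunsky \<alpha>" and zc: "zeros_ccw (popuc \<alpha> (exp (\<i> * complex_of_real \<xi>)) M) M \<zeta>"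
    and k: "1 \<le> k" "k \<le> M" and \<theta>: "0 \<le> \<theta>" "\<theta> < 2 * pi"
    and lo: "pruefer_phase \<alpha> 0 (M - 1) \<le> 2 * pi - \<xi>"
    and hi: "2 * pi * real k - \<xi> \<le> pruefer_phase \<alpha> \<theta> (M - 1)"
  shows "Arg2pi (\<zeta> k) \<le> \<theta>"
proof (rule ccontr)
  assume "\<not> Arg2pi (\<zeta> k) \<le> \<theta>"
  then have gt: "\<theta> < Arg2pi (\<zeta> k)" by simp
  define P where "P = (\<lambda>t. pruefer_phase \<alpha> t (M - 1))"
  define Z where "Z = {z. poly (popuc \<alpha> (exp (\<i> * complex_of_real \<xi>)) M) z = 0}"
  have bij: "bij_betw \<zeta> {1..M} Z" and mono: "strict_mono_on {1..M} (\<lambda>j. Arg2pi (\<zeta> j))"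
    using zc by (auto simp: zeros_ccw_def Z_def)
  have "\<exists>t. 0 \<le> t \<and> t \<le> \<theta> \<and> P t = 2 * pi * real j - \<xi>" if j: "j \<in> {1..k}" for j
  proof (rule IVT')
    have "2 * pi * 1 \<le> 2 * pi * real j" using j by (intro mult_left_mono) auto
    then show "P 0 \<le> 2 * pi * real j - \<xi>" using lo unfolding P_def by linarith
    have "2 * pi * real j \<le> 2 * pi * real k" using j by (intro mult_left_mono) auto
    then show "2 * pi * real j - \<xi> \<le> P \<theta>" using hi unfolding P_def by linarith
    show "continuous_on {0..\<theta>} P"
      using continuous_on_pruefer_phase[OF v] unfolding P_def by (rule continuous_on_subset) simp
  qed (use \<theta> in simp)
  then obtain t where t: "\<And>j. j \<in> {1..k} \<Longrightarrow> 0 \<le> t j \<and> t j \<le> \<theta> \<and> P (t j) = 2 * pi * real j - \<xi>"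
    by metis
  have arg: "Arg2pi (cis (t j)) = t j" if "j \<in> {1..k}" for j
    using t[OF that] \<theta> by (intro Arg2pi_cis) auto
  have "inj_on (\<lambda>j. cis (t j)) {1..k}"
  proof (rule inj_onI)
    fix i j assume ij: "i \<in> {1..k}" "j \<in> {1..k}" "cis (t i) = cis (t j)"
    then have "t i = t j" using arg by metis
    then have "2 * pi * real i - \<xi> = 2 * pi * real j - \<xi>" using t ij by metis
    then show "i = j" by simp
  qed
  moreover have "(\<lambda>j. cis (t j)) ` {1..k} \<subseteq> \<zeta> ` {1..<k}"
  proof safe
    fix j assume j: "j \<in> {1..k}"
    have "cis (P (t j)) = cis (2 * pi * real j + (- \<xi>))" using t[OF j] by simp
    also have "\<dots> = cis (- \<xi>)" by (simp only: cis_mult[symmetric] cis_multiple_2pi) simp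
    also have "\<dots> = cnj (exp (\<i> * complex_of_real \<xi>))" by (simp add: cis_cnj flip: cis_conv_exp)
    finally have "cis (t j) \<in> Z"
      using popuc_zero_iff_phase[OF v] by (simp add: Z_def P_def)
    then obtain i where i: "i \<in> {1..M}" "cis (t j) = \<zeta> i"
      using bij by (auto simp: bij_betw_def)
    have "i < k"
    proof (rule ccontr)
      assume "\<not> i < k"
      then have "Arg2pi (\<zeta> k) \<le> Arg2pi (\<zeta> i)"
        using strict_mono_on_leD[OF mono, of k i] i k by auto
      then show False using gt i arg[OF j] t[OF j] by simp
    qed
    then show "cis (t j) \<in> \<zeta> ` {1..<k}" using i by auto
  qed
  ultimately have "card {1..k} \<le> card (\<zeta> ` {1..<k})"
    by (metis card_image card_mono finite_atLeastLessThan finite_imageI)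
  also have "\<dots> \<le> k - 1" using card_image_le[of "{1..<k}" \<zeta>] by simp
  finally show False using k by simp
qed

text \<open>The confinement at $\theta = 0$ with $\phi = \pi/2$ keeps $\eta_n(0)$ in $[-\pi/2, \pi/2]$ for every
$n$. Monotonicity in $\theta$ bounds $\eta_{M-s}(\theta)$ below by $-\pi/2$, uniformly in the
size of the earlier coefficients; the remaining $s - 1$ steps produce the winding.\<close>

lemma kth_zero_le_if_coefficients_small:
  assumes v: "verblunsky \<alpha>" and zc: "zeros_ccw (popuc \<alpha> (exp (\<i> * complex_of_real \<xi>)) M) M \<zeta>"
    and re: "\<And>n. n < M \<Longrightarrow> Re (\<alpha> n) \<le> 0"
    and k: "1 \<le> k" "k \<le> M" and \<theta>: "0 \<le> \<theta>" "\<theta> < 2 * pi"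
    and \<xi>: "pi / 2 \<le> \<xi>" "\<xi> \<le> 3 * pi / 2"
    and R: "R < 1" "\<And>n. M - s \<le> n \<Longrightarrow> n < M \<Longrightarrow> cmod (\<alpha> n) \<le> R" and s: "1 \<le> s" "s \<le> M"
    and wind: "2 * pi * real k \<le> (real s - 1) * (\<theta> - 2 * (R / (1 - R)))"
  shows "Arg2pi (\<zeta> k) \<le> \<theta>"
proof (rule kth_zero_le_if_phase_winds[OF v zc k \<theta>])
  have conf: "- (pi / 2) \<le> pruefer_phase \<alpha> 0 n \<and> pruefer_phase \<alpha> 0 n \<le> pi / 2" if "n \<le> M" for n
    using pruefer_phase_confined[OF v, of n "pi / 2" 0] re that by auto
  show "pruefer_phase \<alpha> 0 (M - 1) \<le> 2 * pi - \<xi>" using conf[of "M - 1"] \<xi> by simp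
  have "- (pi / 2) \<le> pruefer_phase \<alpha> 0 (M - s)" using conf[of "M - s"] by simp
  also have "\<dots> \<le> pruefer_phase \<alpha> \<theta> (M - s)" by (rule pruefer_phase_mono[OF v \<theta>(1)])
  finally have "- (pi / 2) + real (s - 1) * (\<theta> - 2 * (R / (1 - R))) \<le> pruefer_phase \<alpha> \<theta> (M - s + (s - 1))"
    using pruefer_phase_growth[OF v R(1), of "M - s" "s - 1" \<theta>] R(2) s by fastforce
  moreover have "M - s + (s - 1) = M - 1" "real (s - 1) = real s - 1" using s by auto
  ultimately show "2 * pi * real k - \<xi> \<le> pruefer_phase \<alpha> \<theta> (M - 1)" using wind \<xi> by simp
qed

section \<open>The window on which the coefficients are nearly constant\<close>

text \<open>For $f(n) = -Cn^{-b}$ the scale $t_M = M^{(1+b)/2}$ lies in order of growth strictly between $1/|f(M)|$, which is of order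
$M^b$, and $M$. The lower comparison makes $t_M|f(M)| = CM^{(1-b)/2}$ diverge; the upper one gives
$M - t_M = Mx_M$ with $x_M \to 1$, so that $f$ changes by a factor of at most $x_M^{-b}$ on the window.\<close>

lemma power_decay_window:
  assumes p: "power_decay f C b"
  shows "e > 0 \<Longrightarrow> \<forall>\<^sub>F M in sequentially. \<forall>n. real M - decay_scale f M \<le> real n \<longrightarrow> \<bar>f n\<bar> \<le> (1 + e) * \<bar>f M\<bar>"
    and "filterlim (\<lambda>M. real M - decay_scale f M) at_top sequentially"
    and "filterlim (\<lambda>M. decay_scale f M * \<bar>f M\<bar>) at_top sequentially"
proof -
  have C: "0 < C" and b: "0 < b" "b < 1" and f: "\<And>n. n \<ge> 1 \<Longrightarrow> f n = - C * real n powr (- b)"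
    using p by (auto simp: power_decay_def)
  define x where "x = (\<lambda>M::nat. 1 - real M powr ((b - 1) / 2))"
  have "((\<lambda>M::nat. real M powr ((b - 1) / 2)) \<longlongrightarrow> 0) sequentially"
    using b by (intro tendsto_neg_powr filterlim_real_sequentially) auto
  from tendsto_diff[OF tendsto_const[of 1] this] have x: "x \<longlonglongrightarrow> 1" by (simp add: x_def)
  have Mx: "real M - decay_scale f M = real M * x M" if "M \<ge> 1" for M
  proof -
    have "real M powr ((1 + b) / 2) = real M powr (1 + (b - 1) / 2)" by (simp add: field_simps)
    also have "\<dots> = real M * real M powr ((b - 1) / 2)" using that by (simp only: powr_add) simp
    finally show ?thesis by (simp add: decay_scale_power[OF p] x_def algebra_simps)
  qed
  have "filterlim (\<lambda>M. x M * real M) at_top sequentially"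
    by (rule filterlim_tendsto_pos_mult_at_top[OF x _ filterlim_real_sequentially]) simp
  then show "filterlim (\<lambda>M. real M - decay_scale f M) at_top sequentially"
    by (rule filterlim_cong[THEN iffD1, rotated -1, OF _ refl refl])
      (use Mx in \<open>auto simp: mult.commute intro: eventually_sequentiallyI[of 1]\<close>)
  have "filterlim (\<lambda>M::nat. real M powr ((1 - b) / 2)) at_top sequentially"
  proof -
    have "((\<lambda>M::nat. real M powr (- ((1 - b) / 2))) \<longlongrightarrow> 0) sequentially"
      using b by (intro tendsto_neg_powr filterlim_real_sequentially) auto
    from filterlim_inverse_at_top[OF this] show ?thesis
      by (auto simp: powr_minus intro: eventually_sequentiallyI[of 1])
  qed
  then have "filterlim (\<lambda>M::nat. C * real M powr ((1 - b) / 2)) at_top sequentially"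
    by (rule filterlim_tendsto_pos_mult_at_top[OF tendsto_const C])
  moreover have "decay_scale f M * \<bar>f M\<bar> = C * real M powr ((1 - b) / 2)" if "M \<ge> 1" for M
  proof -
    have "decay_scale f M * \<bar>f M\<bar> = C * (real M powr ((1 + b) / 2) * real M powr (- b))"
      using C that by (simp add: f decay_scale_power[OF p] abs_mult)
    also have "\<dots> = C * real M powr ((1 - b) / 2)"
      by (simp add: field_simps flip: powr_add)
    finally show ?thesis .
  qed
  ultimately show "filterlim (\<lambda>M. decay_scale f M * \<bar>f M\<bar>) at_top sequentially"
    by (subst filterlim_cong[OF refl refl]) (auto intro: eventually_sequentiallyI[of 1])
  show "\<forall>\<^sub>F M in sequentially. \<forall>n. real M - decay_scale f M \<le> real n \<longrightarrow> \<bar>f n\<bar> \<le> (1 + e) * \<bar>f M\<bar>"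
    if e: "e > 0"
  proof -
    have "((\<lambda>M. x M powr (- b)) \<longlongrightarrow> 1 powr (- b)) sequentially"
      using x by (intro tendsto_powr tendsto_const) auto
    then have "\<forall>\<^sub>F M in sequentially. x M powr (- b) < 1 + e"
      using e by (intro order_tendstoD) auto
    moreover have "\<forall>\<^sub>F M in sequentially. x M > 0" using x by (intro order_tendstoD) auto
    ultimately show ?thesis using eventually_ge_at_top[of 1]
    proof eventually_elim
      case (elim M)
      show ?case
      proof (intro allI impI)
        fix n assume "real M - decay_scale f M \<le> real n"
        then have n: "real M * x M \<le> real n" using Mx elim by simp
        have pos: "0 < real M * x M" using elim by simp
        have n1: "n \<ge> 1" using n pos by (cases n) auto
        have "\<bar>f n\<bar> = C * real n powr (- b)" using C n1 by (simp add: f abs_mult)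
        also have "\<dots> \<le> C * (real M * x M) powr (- b)"
          using C b n pos by (intro mult_left_mono powr_mono2') auto
        also have "\<dots> = x M powr (- b) * \<bar>f M\<bar>" using elim C by (simp add: f powr_mult abs_mult)
        also have "\<dots> \<le> (1 + e) * \<bar>f M\<bar>" using elim by (intro mult_right_mono) auto
        finally show "\<bar>f n\<bar> \<le> (1 + e) * \<bar>f M\<bar>" .
      qed
    qed
  qed
qed

lemma filterlim_minus_sqrt_at_top:
  "filterlim (\<lambda>n. real n - sqrt (real n)) at_top sequentially"
proof (rule filterlim_at_top_mono)
  show "filterlim (\<lambda>n. -1 + sqrt (real n)) at_top sequentially"
    by (intro filterlim_tendsto_add_at_top[OF tendsto_const]
        filterlim_compose[OF sqrt_at_top filterlim_real_sequentially])
  show "\<forall>\<^sub>F n in sequentially. -1 + sqrt (real n) \<le> real n - sqrt (real n)"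
  proof (intro always_eventually allI)
    fix n :: nat
    have "0 \<le> (sqrt (real n) - 1)\<^sup>2" by simp
    then show "-1 + sqrt (real n) \<le> real n - sqrt (real n)" by (simp add: power2_diff)
  qed
qed

text \<open>As $|f|$ is decreasing, its largest value on the window is bounded by the one at the integer nearest to
$M - \sqrt M$, and every integer $n \ge M - \sqrt M$ is at least that integer.\<close>

lemma sqrt_scale_window:
  assumes neg: "\<And>n. n \<ge> 1 \<Longrightarrow> f n < 0" and inc: "\<And>n. n \<ge> 1 \<Longrightarrow> f n < f (Suc n)"
    and near: "(\<lambda>n. at_nearest f (real n - sqrt (real n)) / f n) \<longlonglongrightarrow> 1"
    and e: "e > 0"
  shows "\<forall>\<^sub>F M in sequentially. \<forall>n\<le>M. real M - sqrt (real M) \<le> real n \<longrightarrow> \<bar>f n\<bar> \<le> (1 + e) * \<bar>f M\<bar>"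
proof -
  have "filterlim (\<lambda>M. real M - sqrt (real M)) at_top sequentially"
      by (rule filterlim_minus_sqrt_at_top)
  then have "\<forall>\<^sub>F M in sequentially. real M - sqrt (real M) \<ge> 1" by (simp add: filterlim_at_top)
  moreover have "\<forall>\<^sub>F M in sequentially. at_nearest f (real M - sqrt (real M)) / f M < 1 + e"
    using near e by (intro order_tendstoD) auto
  ultimately show ?thesis using eventually_ge_at_top[of 1]
  proof eventually_elim
    case (elim M)
    define m where "m = nat (round (real M - sqrt (real M)))"
    have "round (1::real) \<le> round (real M - sqrt (real M))" using elim by (intro round_mono) auto
    then have m: "m \<ge> 1" by (simp add: m_def)
    show ?case
    proof (intro allI impI)
      fix n assume "n \<le> M" and n: "real M - sqrt (real M) \<le> real n"
      from round_mono[OF n] have "m \<le> n" by (simp add: m_def)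
      then have "f m \<le> f n"
      proof (induction n rule: dec_induct)
        case (step i)
        then show ?case using inc[of i] m by simp
      qed simp
      moreover have "f n < 0" "f M < 0" "f m < 0" using neg m \<open>m \<le> n\<close> elim by auto
      moreover from this have "f m \<ge> (1 + e) * f M"
        using elim by (simp add: at_nearest_def m_def field_simps)
      ultimately show "\<bar>f n\<bar> \<le> (1 + e) * \<bar>f M\<bar>" by (simp add: abs_if)
    qed
  qed
qed

text \<open>The hypothesis speaks of $f(n - \sqrt n)^2$; comparability with $f(n)$ moves the argument, and
$f(n)^2 \le |f(n)|$ for large $n$ removes the square.\<close>

lemma sqrt_scale_diverges:
  assumes div: "filterlim (\<lambda>n. sqrt (real n) * (at_nearest f (real n - sqrt (real n)))\<^sup>2) at_top sequentially"
    and near: "(\<lambda>n. at_nearest f (real n - sqrt (real n)) / f n) \<longlonglongrightarrow> 1"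
    and lim: "f \<longlonglongrightarrow> 0"
  shows "filterlim (\<lambda>n. sqrt (real n) * \<bar>f n\<bar>) at_top sequentially"
proof -
  define g where "g = (\<lambda>n. at_nearest f (real n - sqrt (real n)))"
  have g: "(\<lambda>n. g n / f n) \<longlonglongrightarrow> 1" using near by (simp add: g_def)
  from tendsto_inverse[OF tendsto_power[OF this, of 2]]
  have "(\<lambda>n. inverse ((g n / f n)\<^sup>2)) \<longlonglongrightarrow> 1" by simp
  from filterlim_tendsto_pos_mult_at_top[OF this _ div]
  have "filterlim (\<lambda>n. inverse ((g n / f n)\<^sup>2) * (sqrt (real n) * (g n)\<^sup>2)) at_top sequentially"
    by (simp add: g_def)
  then show ?thesis
  proof (rule filterlim_at_top_mono)
    have "\<forall>\<^sub>F n in sequentially. g n / f n > 0" using g by (intro order_tendstoD) auto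
    moreover have "\<forall>\<^sub>F n in sequentially. \<bar>f n\<bar> < 1"
      using tendsto_rabs[OF lim] by (intro order_tendstoD) auto
    ultimately show "\<forall>\<^sub>F n in sequentially. inverse ((g n / f n)\<^sup>2) * (sqrt (real n) * (g n)\<^sup>2) \<le> sqrt (real n) * \<bar>f n\<bar>"
    proof eventually_elim
      case (elim n)
      then have "g n \<noteq> 0" "f n \<noteq> 0" by auto
      then have "inverse ((g n / f n)\<^sup>2) * (sqrt (real n) * (g n)\<^sup>2) = sqrt (real n) * \<bar>f n\<bar>\<^sup>2"
        by (simp add: field_simps)
      also have "\<bar>f n\<bar>\<^sup>2 \<le> \<bar>f n\<bar>"
        using elim by (simp only: power2_eq_square) (intro mult_left_le, auto)
      finally show ?case by (simp add: mult_left_mono)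
    qed
  qed
qed

text \<open>Both kinds of decay lead to the same three facts, which make the phase rotate: a window
of length $t_M$ fits below $M$, the coefficients on it are at most slightly larger than $|f(M)|$, and it is
long compared with $1/|f(M)|$, the time scale of one turn of the phase.\<close>

lemma slow_decay_window:
  assumes sd: "slow_decay \<alpha> f"
  shows "e > 0 \<Longrightarrow> \<forall>\<^sub>F M in sequentially. \<forall>n\<le>M. real M - decay_scale f M \<le> real n \<longrightarrow> cmod (\<alpha> n) \<le> (1 + e) * \<bar>f M\<bar>"
    and "\<forall>\<^sub>F M in sequentially. decay_scale f M \<le> real M"
    and "filterlim (\<lambda>M. decay_scale f M * \<bar>f M\<bar>) at_top sequentially"
proof -
  have neg: "f n < 0" "f n < f (Suc n)" if "n \<ge> 1" for n
    using sd that unfolding slow_decay_def by (meson less_trans)+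
  have "(\<lambda>n. at_nearest f (real n - real 1 * sqrt (real n)) / f n) \<longlonglongrightarrow> 1"
    using sd unfolding slow_decay_def by blast
  then have near: "(\<lambda>n. at_nearest f (real n - sqrt (real n)) / f n) \<longlonglongrightarrow> 1" by simp
  have lim: "f \<longlonglongrightarrow> 0" using sd by (simp add: slow_decay_def)
  have *: "(\<forall>e>0. \<forall>\<^sub>F M in sequentially. \<forall>n\<le>M. real M - decay_scale f M \<le> real n \<longrightarrow> \<bar>f n\<bar> \<le> (1 + e) * \<bar>f M\<bar>)
    \<and> filterlim (\<lambda>M. real M - decay_scale f M) at_top sequentially
    \<and> filterlim (\<lambda>M. decay_scale f M * \<bar>f M\<bar>) at_top sequentially"
  proof (cases "\<exists>C b. power_decay f C b")
    case True
    then obtain C b where "power_decay f C b" by blast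
    note w = power_decay_window[OF this]
    show ?thesis
    proof (intro conjI allI impI)
      fix e :: real assume "e > 0"
      from w(1)[OF this]
      show "\<forall>\<^sub>F M in sequentially. \<forall>n\<le>M. real M - decay_scale f M \<le> real n \<longrightarrow> \<bar>f n\<bar> \<le> (1 + e) * \<bar>f M\<bar>"
        by (rule eventually_mono) simp
    qed (rule w)+
  next
    case False
    then have sc: "decay_scale f = (\<lambda>M. sqrt (real M))" by (simp add: decay_scale_def fun_eq_iff)
    have div: "filterlim (\<lambda>n. sqrt (real n) * (at_nearest f (real n - sqrt (real n)))\<^sup>2) at_top sequentially"
      using sd False by (auto simp: slow_decay_def)
    have "filterlim (\<lambda>M. real M - sqrt (real M)) at_top sequentially"
      by (rule filterlim_minus_sqrt_at_top)
    then show ?thesis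
      using sqrt_scale_window[OF neg near] sqrt_scale_diverges[OF div near lim] by (simp add: sc)
  qed
  then show "filterlim (\<lambda>M. decay_scale f M * \<bar>f M\<bar>) at_top sequentially" by blast
  from * have far: "filterlim (\<lambda>M. real M - decay_scale f M) at_top sequentially" by blast
  then have "\<forall>\<^sub>F M in sequentially. 0 \<le> real M - decay_scale f M"
    unfolding filterlim_at_top by blast
  then show "\<forall>\<^sub>F M in sequentially. decay_scale f M \<le> real M" by simp
  show "\<forall>\<^sub>F M in sequentially. \<forall>n\<le>M. real M - decay_scale f M \<le> real n \<longrightarrow> cmod (\<alpha> n) \<le> (1 + e) * \<bar>f M\<bar>"
    if e: "e > 0"
  proof -
    \<comment> \<open>The errors of $\alpha_n/f(n)$ and of $f(n)/f(M)$ multiply, so each gets a $d$ with $(1+d)^2 \le 1+e$.\<close>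
    define d where "d = min 1 (e / 3)"
    have d: "0 < d" "d \<le> 1" "3 * d \<le> e" using e by (auto simp: d_def)
    have "d * d \<le> d * 1" using d by (intro mult_left_mono) auto
    moreover have "(1 + d) * (1 + d) = 1 + 2 * d + d * d" by (simp add: algebra_simps)
    ultimately have dd: "(1 + d) * (1 + d) \<le> 1 + e" using d by linarith
    have "(\<lambda>n. \<alpha> n / complex_of_real (f n)) \<longlonglongrightarrow> 1" using sd by (simp add: slow_decay_def)
    from tendsto_norm[OF this] have "\<forall>\<^sub>F n in sequentially. cmod (\<alpha> n / complex_of_real (f n)) < 1 + d"
      using d by (intro order_tendstoD) auto
    then obtain n0 where n0: "\<And>n. n \<ge> n0 \<Longrightarrow> cmod (\<alpha> n / complex_of_real (f n)) < 1 + d"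
      by (auto simp: eventually_sequentially)
    have "\<forall>\<^sub>F M in sequentially. real (n0 + 1) \<le> real M - decay_scale f M"
      using far unfolding filterlim_at_top by blast
    moreover have "\<forall>\<^sub>F M in sequentially. \<forall>n\<le>M. real M - decay_scale f M \<le> real n \<longrightarrow> \<bar>f n\<bar> \<le> (1 + d) * \<bar>f M\<bar>"
      using * d by blast
    ultimately show ?thesis
    proof eventually_elim
      case (elim M)
      show ?case
      proof (intro allI impI)
        fix n assume n: "n \<le> M" "real M - decay_scale f M \<le> real n"
        then have "real (n0 + 1) \<le> real n" using elim by linarith
        then have n1: "n \<ge> n0" "n \<ge> 1" by auto
        have "cmod (\<alpha> n) < (1 + d) * \<bar>f n\<bar>"
          using n0[OF n1(1)] neg(1)[OF n1(2)] by (simp add: norm_divide field_simps)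
        also have "\<dots> \<le> (1 + d) * ((1 + d) * \<bar>f M\<bar>)"
          using elim n d by (intro mult_left_mono) auto
        also have "\<dots> \<le> (1 + e) * \<bar>f M\<bar>"
          unfolding mult.assoc[symmetric] by (intro mult_right_mono dd) auto
        finally show "cmod (\<alpha> n) \<le> (1 + e) * \<bar>f M\<bar>" by simp
      qed
    qed
  qed
qed

text \<open>The smallness conditions on $|f(M)|$ under which the lemmas on zeros apply with
$\theta = 2|f(M)|(1+\delta/2)$ and $R = (1+\delta/8)|f(M)|$. In the last one, $1 - R \to 1$ is absorbed by
enlarging $\delta/8$ to $\delta/4$, which leaves a gain of $|f(M)|\delta/2$ per step.\<close>

lemma eventually_arc_constants:
  assumes f: "f \<longlonglongrightarrow> 0" and pos: "(0::real) < \<delta>" "0 < \<epsilon>"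
  shows "\<forall>\<^sub>F M in sequentially. 2 * \<bar>f M\<bar> * (1 + \<delta> / 2) < 2 * pi \<and> \<bar>f M\<bar> * \<delta> \<le> 1 \<and> \<bar>f M\<bar> < 1 \<and>
      (1 + \<delta> / 8) * \<bar>f M\<bar> < 1 \<and> (1 + \<delta> / 8) * \<bar>f M\<bar> < \<epsilon> \<and>
      (1 + \<delta> / 8) * \<bar>f M\<bar> / (1 - (1 + \<delta> / 8) * \<bar>f M\<bar>) \<le> (1 + \<delta> / 4) * \<bar>f M\<bar>"
proof -
  have f0: "(\<lambda>M. \<bar>f M\<bar>) \<longlonglongrightarrow> 0" using tendsto_rabs[OF f] by simp
  have small: "\<forall>\<^sub>F M in sequentially. c * \<bar>f M\<bar> < r" if "r > 0" for c r :: real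
    using that tendsto_mult_right_zero[OF f0, of c] by (intro order_tendstoD) auto
  have ne: "0 < (\<delta> / 8) / (1 + \<delta> / 4)" using pos by simp
  show ?thesis
    using small[OF pi_gt_zero, of "1 + \<delta> / 2"] small[of 1 \<delta>, OF zero_less_one] small[of 1 1, OF zero_less_one]
      small[of 1 "1 + \<delta> / 8", OF zero_less_one] small[of \<epsilon> "1 + \<delta> / 8", OF pos(2)] small[OF ne, of "1 + \<delta> / 8"]
  proof eventually_elim
    case (elim M)
    define R where "R = (1 + \<delta> / 8) * \<bar>f M\<bar>"
    have "R * (1 + \<delta> / 4) \<le> \<delta> / 8" using elim(6) pos pos_less_divide_eq[of "1 + \<delta> / 4" R "\<delta> / 8"]
      by (simp add: R_def)
    then have "(1 + \<delta> / 8) \<le> (1 + \<delta> / 4) * (1 - R)" by (simp add: algebra_simps)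
    then have "(1 + \<delta> / 8) * \<bar>f M\<bar> \<le> (1 + \<delta> / 4) * (1 - R) * \<bar>f M\<bar>" by (intro mult_right_mono) auto
    then have "R \<le> (1 + \<delta> / 4) * \<bar>f M\<bar> * (1 - R)" by (simp add: R_def mult_ac)
    then have R: "R / (1 - R) \<le> (1 + \<delta> / 4) * \<bar>f M\<bar>" using elim(4) by (simp add: R_def pos_divide_le_eq)
    have "2 * ((1 + \<delta> / 2) * \<bar>f M\<bar>) < 2 * pi"
      using elim(1) by (rule mult_strict_left_mono) simp
    then have "2 * \<bar>f M\<bar> * (1 + \<delta> / 2) < 2 * pi" by (simp only: mult_ac)
    then show ?case using elim R by (simp add: R_def mult.commute)
  qed
qed

section \<open>The limit of the rescaled arguments\<close>

theorem theorem4p1: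
  fixes k :: nat and \<delta> \<epsilon> \<xi> :: real and \<beta> :: complex
    and f :: "nat \<Rightarrow> real" and \<alpha>' :: "nat \<Rightarrow> real"
  assumes "k \<ge> 1" and "\<delta> > 0" and "\<epsilon> > 0"
    and "\<xi> \<in> {pi / 2 + \<epsilon> <..< 3 * pi / 2 - \<epsilon>}"
    and "\<beta> = exp (\<i> * complex_of_real \<xi>)"
    and "\<forall>n. \<alpha>' n \<in> {-1 <..< 1}"
    and "slow_decay (\<lambda>n. complex_of_real (\<alpha>' n)) f"
  shows "\<exists>M0 N0. \<forall>M\<ge>M0. \<forall>N\<ge>N0. \<forall>(\<alpha> :: nat \<Rightarrow> complex) (\<zeta> :: nat \<Rightarrow> complex).
           verblunsky \<alpha> \<longrightarrow>
           (\<forall>n\<le>M. \<alpha> n \<in> P_region (\<alpha> M)) \<longrightarrow>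
           (\<forall>n. real n \<in> {real M - real N * (decay_scale f M + 4) <.. real M} \<longrightarrow>
                \<alpha> n = complex_of_real (\<alpha>' n)) \<longrightarrow>
           zeros_ccw (popuc \<alpha> \<beta> M) M \<zeta> \<longrightarrow>
           \<bar>Arg2pi (\<zeta> k) / (2 * \<bar>f M\<bar>) - 1\<bar> < \<delta>"
proof -
  define t where "t = decay_scale f"
  have k: "k \<ge> 1" and \<delta>: "\<delta> > 0" and \<epsilon>: "\<epsilon> > 0"
    and \<xi>: "\<xi> \<in> {pi / 2 + \<epsilon> <..< 3 * pi / 2 - \<epsilon>}"
    and sd: "slow_decay (\<lambda>n. complex_of_real (\<alpha>' n)) f" using assms by auto
  have f0: "f \<longlonglongrightarrow> 0" and neg: "\<And>n. n \<ge> 1 \<Longrightarrow> f n < 0"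
    using sd unfolding slow_decay_def by (blast, meson less_trans)
  have "(\<lambda>n. complex_of_real (\<alpha>' n) / complex_of_real (f n)) \<longlonglongrightarrow> 1"
    using sd by (simp add: slow_decay_def)
  from tendsto_Re[OF this] have "(\<lambda>n. \<alpha>' n / f n) \<longlonglongrightarrow> 1" by (simp flip: of_real_divide)
  then have "\<forall>\<^sub>F M in sequentially. \<alpha>' M / f M > max 0 (1 - \<delta> / 2)"
    using \<delta> by (intro order_tendstoD) auto
  moreover have "\<forall>\<^sub>F M in sequentially. t M * \<bar>f M\<bar> \<ge> 2 / \<delta> * (2 * pi * k + 1) + 1"
    using slow_decay_window(3)[OF sd] unfolding filterlim_at_top t_def by blast
  moreover have "\<forall>\<^sub>F M in sequentially. \<forall>n\<le>M. real M - t M \<le> real n \<longrightarrow>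
      cmod (complex_of_real (\<alpha>' n)) \<le> (1 + \<delta> / 8) * \<bar>f M\<bar>"
    using slow_decay_window(1)[OF sd, of "\<delta> / 8"] \<delta> by (simp add: t_def)
  moreover have "\<forall>\<^sub>F M in sequentially. t M \<le> real M"
    using slow_decay_window(2)[OF sd] by (simp add: t_def)
  moreover note eventually_arc_constants[OF f0 \<delta> \<epsilon>]
  ultimately have "\<forall>\<^sub>F M in sequentially. \<forall>N\<ge>1. \<forall>(\<alpha> :: nat \<Rightarrow> complex) (\<zeta> :: nat \<Rightarrow> complex).
           verblunsky \<alpha> \<longrightarrow>
           (\<forall>n\<le>M. \<alpha> n \<in> P_region (\<alpha> M)) \<longrightarrow>
           (\<forall>n. real n \<in> {real M - real N * (decay_scale f M + 4) <.. real M} \<longrightarrow>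
                \<alpha> n = complex_of_real (\<alpha>' n)) \<longrightarrow>
           zeros_ccw (popuc \<alpha> \<beta> M) M \<zeta> \<longrightarrow>
           \<bar>Arg2pi (\<zeta> k) / (2 * \<bar>f M\<bar>) - 1\<bar> < \<delta>"
    using eventually_ge_at_top[of k]
  proof eventually_elim
    case (elim M)
    show ?case
    proof (intro allI impI)
      fix N :: nat and \<alpha> \<zeta> :: "nat \<Rightarrow> complex"
      assume N: "1 \<le> N" and v: "verblunsky \<alpha>" and P: "\<forall>n\<le>M. \<alpha> n \<in> P_region (\<alpha> M)"
        and eq: "\<forall>n. real n \<in> {real M - real N * (decay_scale f M + 4) <.. real M} \<longrightarrow>
                \<alpha> n = complex_of_real (\<alpha>' n)"
        and zc: "zeros_ccw (popuc \<alpha> \<beta> M) M \<zeta>"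
      define F where "F = \<bar>f M\<bar>"
      define R where "R = (1 + \<delta> / 8) * F"
      define \<theta> where "\<theta> = 2 * F * (1 + \<delta> / 2)"
      have M1: "M \<ge> 1" using elim k by linarith
      have F: "0 < F" "F < 1" "F * \<delta> \<le> 1" "R < 1" "R < \<epsilon>" "R / (1 - R) \<le> (1 + \<delta> / 4) * F"
        and \<theta>: "\<theta> < 2 * pi"
        using elim neg[OF M1] by (simp_all add: F_def R_def \<theta>_def)
      have \<theta>0: "0 \<le> \<theta>" using F(1) \<delta> by (simp add: \<theta>_def)
      have tF: "t M * F \<ge> 2 / \<delta> * (2 * pi * k + 1) + 1" using elim by (simp add: F_def)
      have "0 \<le> 2 / \<delta> * (2 * pi * k + 1)" using \<delta> by simp
      then have "1 \<le> t M * F" using tF by linarith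
      then have "0 < t M * F" by linarith
      then have "0 \<le> t M" using F by (simp add: zero_less_mult_iff)
      then have "t M * F \<le> t M * 1" using F by (intro mult_left_mono) auto
      then have t1: "1 \<le> t M" using \<open>1 \<le> t M * F\<close> by linarith
      have long: "1 * (t M + 4) \<le> real N * (t M + 4)" using N t1 by (intro mult_right_mono) auto
      have eq': "\<alpha> n = complex_of_real (\<alpha>' n)" if n: "n \<le> M" "real M - t M \<le> real n" for n
      proof -
        have "real M - real N * (t M + 4) \<le> real M - 1 * (t M + 4)"
          using long by (rule diff_left_mono)
        also have "\<dots> < real n" using n by simp
        finally show ?thesis using eq n(1) by (simp add: t_def)
      qed
      have small: "cmod (\<alpha> n) \<le> R" if "n \<le> M" "real M - t M \<le> real n" for n
        using elim that eq'[OF that] by (simp add: R_def F_def)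
      define a where "a = - \<alpha>' M"
      have \<alpha>M: "\<alpha> M = - complex_of_real a" using eq'[of M] t1 by (simp add: a_def)
      have "0 < \<alpha>' M / f M" "1 - \<delta> / 2 < \<alpha>' M / f M" using elim by auto
      then have a: "0 < a" "(1 - \<delta> / 2) * F < a"
        using neg[OF M1] by (auto simp: a_def F_def field_simps zero_less_divide_iff)
      have aR: "a \<le> R" using small[of M] t1 a by (simp add: \<alpha>M)
      have re: "Re (\<alpha> n) \<le> - a" if "n < M" for n
        using P that by (simp add: P_region_def \<alpha>M)
      have "\<zeta> k \<in> {z. poly (popuc \<alpha> \<beta> M) z = 0}"
        using zc k elim by (auto simp: zeros_ccw_def bij_betw_def)
      then have lower: "2 * a < Arg2pi (\<zeta> k)"
        using a aR F by (intro popuc_zero_free_arc[OF v re _ _ _ \<xi>]) (auto simp: assms(5))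
      define s where "s = nat \<lfloor>t M\<rfloor>"
      have s: "1 \<le> s" "real s \<le> t M" "t M \<le> real s + 1" using t1 by (auto simp: s_def) linarith+
      have sM: "s \<le> M" using s elim by linarith
      have upper: "Arg2pi (\<zeta> k) \<le> \<theta>"
      proof (rule kth_zero_le_if_coefficients_small[OF v zc[unfolded assms(5)] _ k _ \<theta>0 \<theta>])
        show "cmod (\<alpha> n) \<le> R" if "M - s \<le> n" "n < M" for n
          using that s sM by (intro small) linarith+
        show "Re (\<alpha> n) \<le> 0" if "n < M" for n using re[OF that] a by simp
        \<comment> \<open>The extra $1$ pays for the at most two steps lost to rounding $t_M$ and to stopping at $M - 1$,
          each of them worth $F\delta/2 \le 1/2$.\<close>
        have "2 * pi * k + 1 \<le> (\<delta> / 2) * (t M * F)"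
        proof -
          have "2 * pi * k + 1 = (\<delta> / 2) * (2 / \<delta> * (2 * pi * k + 1))" using \<delta> by simp
          also have "\<dots> \<le> (\<delta> / 2) * (t M * F)" using tF \<delta> by (intro mult_left_mono) linarith+
          finally show ?thesis .
        qed
        then have "2 * pi * k \<le> (t M - 2) * (F * \<delta> / 2)" using F by (simp add: algebra_simps)
        also have "\<dots> \<le> (real s - 1) * (F * \<delta> / 2)"
          using s F \<delta> by (intro mult_right_mono) auto
        also have "\<dots> \<le> (real s - 1) * (\<theta> - 2 * (R / (1 - R)))"
          using s F(6) by (intro mult_left_mono) (simp_all add: \<theta>_def algebra_simps)
        finally show "2 * pi * k \<le> (real s - 1) * (\<theta> - 2 * (R / (1 - R)))" .
      qed (use elim s sM \<xi> \<epsilon> F in auto)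
      have "1 - \<delta> / 2 < Arg2pi (\<zeta> k) / (2 * F)"
        using lower a F by (simp add: field_simps)
      moreover have "Arg2pi (\<zeta> k) / (2 * F) \<le> 1 + \<delta> / 2"
        using upper F by (simp add: field_simps \<theta>_def)
      ultimately show "\<bar>Arg2pi (\<zeta> k) / (2 * \<bar>f M\<bar>) - 1\<bar> < \<delta>"
        using \<delta> unfolding F_def[symmetric] by linarith
    qed
  qed
  then show ?thesis unfolding eventually_sequentially by blast
qed

end
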